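(* The space $(\mathbb{Z}[i]\setminus\{0\},\mathcal{T})$, where $\mathcal{T}$ is the coprimality topology, is both hyperconnected and ultraconnected.
   Context: $\mathbb{Z}[i]$ is the ring of Gaussian integers; $\gcd(\alpha,\beta)\sim 1$ means that $\alpha$ and $\beta$ are coprime, i.e. their greatest common divisor is a unit. For $\alpha\in\mathbb{Z}[i]\setminus\{0\}$ put $\sigma_\alpha=\{\beta\in\mathbb{Z}[i]\setminus\{0\}:\gcd(\alpha,\beta)\sim 1\}$. The coprimality topology $\mathcal{T}$ on $\mathbb{Z}[i]\setminus\{0\}$ is the topology generated by the collection $\{\sigma_\alpha:\alpha\in\mathbb{Z}[i]\setminus\{0\}\}$. A topological space is hyperconnected if every two nonempty open sets have nonempty intersection, and ultraconnected if every two nonempty closed sets have nonempty intersection. *)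

theory Defs
  imports "HOL-Analysis.Analysis" "HOL-Algebra.Divisibility" "HOL-Algebra.Ring"
begin

definition gaussian_integers :: "complex ring" where
  "gaussian_integers =
     \<lparr>carrier = {of_int a + \<i> * of_int b | a b. True},
      mult = (*), one = 1, zero = 0, add = (+)\<rparr>"

abbreviation gaussian_nonzero :: "complex set" where
  "gaussian_nonzero \<equiv> carrier gaussian_integers - {\<zero>\<^bsub>gaussian_integers\<^esub>}"

text \<open>
  A greatest common divisor is determined only up to a unit, so "the gcd is a unit" is expressed
  through the relation \<^const>\<open>isgcd\<close>: all greatest common divisors of two given elements
  are associated, hence one of them is a unit iff all of them are.
\<close>

definition unit_gcd :: "complex \<Rightarrow> complex \<Rightarrow> bool" where
  "unit_gcd \<alpha> \<beta> \<longleftrightarrow>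
     (\<exists>\<delta> \<in> Units gaussian_integers. \<delta> gcdof\<^bsub>gaussian_integers\<^esub> \<alpha> \<beta>)"

definition coprime_set :: "complex \<Rightarrow> complex set" where
  "coprime_set \<alpha> = {\<beta> \<in> gaussian_nonzero. unit_gcd \<alpha> \<beta>}"

definition coprimality_topology :: "complex topology" where
  "coprimality_topology = topology_generated_by (coprime_set ` gaussian_nonzero)"

definition hyperconnected_space :: "'a topology \<Rightarrow> bool" where
  "hyperconnected_space X \<longleftrightarrow>
     (\<forall>U V. openin X U \<and> U \<noteq> {} \<and> openin X V \<and> V \<noteq> {} \<longrightarrow> U \<inter> V \<noteq> {})"

definition ultraconnected_space :: "'a topology \<Rightarrow> bool" where
  "ultraconnected_space X \<longleftrightarrow>
     (\<forall>C D. closedin X C \<and> C \<noteq> {} \<and> closedin X D \<and> D \<noteq> {} \<longrightarrow> C \<inter> D \<noteq> {})"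

lemma gaussian_integers_simps [simp]:
  "mult gaussian_integers = (*)" "one gaussian_integers = 1"
  "zero gaussian_integers = 0" "add gaussian_integers = (+)"
  by (simp_all add: gaussian_integers_def)

lemma carrier_gaussian_integers:
  "carrier gaussian_integers = {z. Re z \<in> \<int> \<and> Im z \<in> \<int>}"
  by (auto simp: gaussian_integers_def complex_eq_iff elim!: Ints_cases)

lemma domain_gaussian_integers: "domain gaussian_integers"
proof -
  interpret cring gaussian_integers
  proof (rule cringI)
    show "abelian_group gaussian_integers"
    proof (rule abelian_groupI)
      fix x assume "x \<in> carrier gaussian_integers"
      then show "\<exists>y\<in>carrier gaussian_integers. y \<oplus>\<^bsub>gaussian_integers\<^esub> x = \<zero>\<^bsub>gaussian_integers\<^esub>"
        by (intro bexI[of _ "- x"]) (auto simp: carrier_gaussian_integers)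
    qed (auto simp: carrier_gaussian_integers)
    show "comm_monoid gaussian_integers"
      by (rule comm_monoidI) (auto simp: carrier_gaussian_integers)
  qed (auto simp: algebra_simps)
  show ?thesis
    by unfold_locales auto
qed

lemma topspace_coprimality_topology: "topspace coprimality_topology = gaussian_nonzero"
proof
  show "topspace coprimality_topology \<subseteq> gaussian_nonzero"
    by (auto simp: coprimality_topology_def coprime_set_def)
  interpret domain gaussian_integers by (rule domain_gaussian_integers)
  have "unit_gcd 1 \<beta>" if "\<beta> \<in> gaussian_nonzero" for \<beta>
    unfolding unit_gcd_def isgcd_def factor_def
    using that one_closed Units_one_closed by (intro bexI[of _ 1]) auto
  then have "gaussian_nonzero \<subseteq> coprime_set 1"
    by (auto simp: coprime_set_def)
  moreover have "1 \<in> gaussian_nonzero"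
    using one_closed by simp
  ultimately show "gaussian_nonzero \<subseteq> topspace coprimality_topology"
    by (auto simp: coprimality_topology_def)
qed

end

theory Submission
  imports Defs
begin

text \<open>
  Both properties express that every open set is closed under taking divisors. For a generator
  \<open>\<sigma>\<^sub>\<alpha>\<close> this holds because a common divisor of \<open>\<alpha>\<close> and a divisor of \<open>\<beta>\<close> is also a common divisor
  of \<open>\<alpha>\<close> and \<open>\<beta>\<close>; being closed under divisors is preserved by arbitrary unions and intersections,
  so it passes to all open sets. Since \<open>1\<close> divides everything, any two nonempty open sets meet in
  \<open>1\<close>. Dually, closed sets are closed under taking nonzero multiples, so if \<open>x\<close> lies in one closed
  set and \<open>y\<close> in another, both sets contain \<open>x * y\<close>.
\<close>

text \<open>
  The unit that is a greatest common divisor of \<open>\<alpha>\<close> and \<open>\<beta>\<close> serves again for \<open>\<alpha>\<close> and \<open>\<gamma>\<close>: as a unit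
  it divides \<open>\<gamma>\<close>, and \<open>\<alpha>\<close>, \<open>\<gamma>\<close> have no common divisors beyond those of \<open>\<alpha>\<close>, \<open>\<beta>\<close>.
\<close>

lemma unit_gcd_divisor:
  assumes "unit_gcd \<alpha> \<beta>" "\<gamma> \<in> carrier gaussian_integers" "\<gamma> divides\<^bsub>gaussian_integers\<^esub> \<beta>"
  shows "unit_gcd \<alpha> \<gamma>"
proof -
  interpret domain gaussian_integers by (rule domain_gaussian_integers)
  obtain \<delta> where "\<delta> \<in> Units gaussian_integers" "\<delta> gcdof\<^bsub>gaussian_integers\<^esub> \<alpha> \<beta>"
    using assms(1) by (auto simp: unit_gcd_def)
  moreover from this have "\<delta> divides\<^bsub>gaussian_integers\<^esub> \<gamma>"
    using assms(2) unit_divides by blast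
  ultimately have "\<delta> gcdof\<^bsub>gaussian_integers\<^esub> \<alpha> \<gamma>"
    using divides_trans[OF _ assms(3)] unfolding isgcd_def by blast
  with \<open>\<delta> \<in> Units gaussian_integers\<close> show ?thesis
    by (auto simp: unit_gcd_def)
qed

lemma openin_coprimality_divisor:
  assumes "openin coprimality_topology U" "\<beta> \<in> U"
    and "\<gamma> \<in> gaussian_nonzero" "\<gamma> divides\<^bsub>gaussian_integers\<^esub> \<beta>"
  shows "\<gamma> \<in> U"
proof -
  have "generate_topology_on (coprime_set ` gaussian_nonzero) U"
    using assms(1) by (simp add: coprimality_topology_def openin_topology_generated_by_iff)
  then show ?thesis
    using assms(2)
  proof induction
    case (Basis s)
    then show ?case
      using assms(3,4) unit_gcd_divisor by (auto simp: coprime_set_def)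
  qed auto
qed

lemma closedin_coprimality_multiple:
  assumes "closedin coprimality_topology C" "\<gamma> \<in> C"
    and "\<beta> \<in> gaussian_nonzero" "\<gamma> divides\<^bsub>gaussian_integers\<^esub> \<beta>"
  shows "\<beta> \<in> C"
  using assms openin_coprimality_divisor[of "gaussian_nonzero - C" \<beta> \<gamma>]
  by (auto simp: closedin_def topspace_coprimality_topology)

lemma hyperconnected_coprimality: "hyperconnected_space coprimality_topology"
proof -
  interpret domain gaussian_integers by (rule domain_gaussian_integers)
  have "1 \<in> U" if "openin coprimality_topology U" "\<beta> \<in> U" for U \<beta>
  proof (rule openin_coprimality_divisor[OF that])
    have "\<beta> \<in> carrier gaussian_integers"
      using that openin_subset topspace_coprimality_topology by blast
    then show "1 divides\<^bsub>gaussian_integers\<^esub> \<beta>"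
      by (auto simp: factor_def)
    show "1 \<in> gaussian_nonzero"
      using one_closed by simp
  qed
  then show ?thesis
    unfolding hyperconnected_space_def by blast
qed

lemma ultraconnected_coprimality: "ultraconnected_space coprimality_topology"
  unfolding ultraconnected_space_def
proof (intro allI impI, elim conjE)
  fix C D
  assume C: "closedin coprimality_topology C" "C \<noteq> {}"
    and D: "closedin coprimality_topology D" "D \<noteq> {}"
  interpret domain gaussian_integers by (rule domain_gaussian_integers)
  obtain x y where xy: "x \<in> C" "y \<in> D"
    using C(2) D(2) by blast
  have nonzero: "x \<in> gaussian_nonzero" "y \<in> gaussian_nonzero"
    using C(1) D(1) xy closedin_subset topspace_coprimality_topology by blast+
  have prod: "x * y \<in> gaussian_nonzero"
    using nonzero m_closed[of x y] by simp
  have "x divides\<^bsub>gaussian_integers\<^esub> x * y" "y divides\<^bsub>gaussian_integers\<^esub> x * y"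
    using nonzero by (auto simp: factor_def mult.commute)
  then have "x * y \<in> C" "x * y \<in> D"
    using closedin_coprimality_multiple C(1) D(1) xy prod by blast+
  then show "C \<inter> D \<noteq> {}"
    by blast
qed

theorem theorem3p8:
  shows "hyperconnected_space coprimality_topology \<and> ultraconnected_space coprimality_topology"
  using hyperconnected_coprimality ultraconnected_coprimality by blast

end
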